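(* Let $k,n\in\mathbb{N}$ with $k>2$ and $n>2$. Then $$(k-1)^n \;<\; ah(k,n)\;\le\;\frac{(k-1)^2-2}{k-1}\cdot k^{n-1}+\frac{k+1}{k-1}.$$
   Context: For $k,n\in\mathbb{N}$, $[k]=\{1,\dots,k\}$ and $[k]^n$ is the set of words $x=(x_1,\dots,x_n)$ with $x_i\in[k]$. A combinatorial line is determined by a word $w\in([k]\cup\{*\})^n$ containing at least one $*$; it consists of the $k$ points $w(1),\dots,w(k)$, where $w(i)$ is obtained from $w$ by replacing every $*$ by $i$. An $r$-coloring of $[k]^n$ is a coloring of all points of $[k]^n$ using exactly $r$ colors. A combinatorial line is rainbow if its $k$ points receive $k$ pairwise different colors; a coloring is rainbow-free if it has no rainbow combinatorial line. The anti-Hales–Jewett number $ah(k,n)$ is the least $r$ such that every $r$-coloring of $[k]^n$ contains a rainbow combinatorial line. *)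

theory Defs
  imports Complex_Main
begin

definition cube :: "nat \<Rightarrow> nat \<Rightarrow> nat list set" where
  "cube k n = {x. length x = n \<and> set x \<subseteq> {1..k}}"

text \<open>The wildcard * is represented by \<^term>\<open>None\<close>.\<close>

definition root_words :: "nat \<Rightarrow> nat \<Rightarrow> nat option list set" where
  "root_words k n = {w. length w = n \<and> set w \<subseteq> insert None (Some ` {1..k}) \<and> None \<in> set w}"

definition fill :: "nat option list \<Rightarrow> nat \<Rightarrow> nat list" where
  "fill w i = map (\<lambda>a. case a of None \<Rightarrow> i | Some j \<Rightarrow> j) w"

definition line :: "nat \<Rightarrow> nat option list \<Rightarrow> nat list set" where
  "line k w = fill w ` {1..k}"

definition combinatorial_lines :: "nat \<Rightarrow> nat \<Rightarrow> nat list set set" where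
  "combinatorial_lines k n = line k ` root_words k n"

text \<open>Colors are natural numbers, which is no restriction since the cube is finite.
  Only the values of a coloring on the cube matter, and all r colors must occur.\<close>

definition is_coloring :: "nat \<Rightarrow> nat \<Rightarrow> nat \<Rightarrow> (nat list \<Rightarrow> nat) \<Rightarrow> bool" where
  "is_coloring r k n c \<longleftrightarrow> card (c ` cube k n) = r"

definition rainbow :: "(nat list \<Rightarrow> nat) \<Rightarrow> nat list set \<Rightarrow> bool" where
  "rainbow c L \<longleftrightarrow> inj_on c L"

text \<open>The number of colors is required to be positive: a nonempty cube has no coloring with
  exactly 0 colors, so \<open>r = 0\<close> would satisfy the condition vacuously. The minimum is over a
  nonempty set, since the condition holds for every \<open>r > k ^ n\<close>.\<close>

definition ah :: "nat \<Rightarrow> nat \<Rightarrow> nat" where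
  "ah k n = (LEAST r. r \<ge> 1 \<and>
     (\<forall>c. is_coloring r k n c \<longrightarrow> (\<exists>L\<in>combinatorial_lines k n. rainbow c L)))"

end

theory Submission
  imports Defs
begin

text \<open>Lower bound: identifying the letters \<open>k - 1\<close> and \<open>k\<close> colors the cube with \<open>(k - 1) ^ n\<close>
  colors so that the last two points of every line agree; merging colors then gives rainbow-free
  colorings with any smaller number of colors.

  Upper bound: cut \<open>[k]\<^bsup>n + 1\<^esup>\<close> into \<open>k\<close> layers, each with at most \<open>F \<ge> 2\<close> colors. The lines
  transversal to the layers force two layers to share a color. If this were the only coincidence
  among the \<open>k\<close> color sets, then all transversal lines would repeat the same color in the same two
  layers, so those layers would be monochromatic. Hence there are at most \<open>k F - 2\<close> colors, and
  iterating \<open>F \<mapsto> k F - 2\<close> from \<open>F = k - 1\<close> gives the bound.\<close>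

section \<open>Rainbow-free colorings, layers and transversal lines\<close>

definition rainbow_free :: "nat \<Rightarrow> nat \<Rightarrow> (nat list \<Rightarrow> nat) \<Rightarrow> bool" where
  "rainbow_free k n c \<longleftrightarrow> (\<forall>L\<in>combinatorial_lines k n. \<not> rainbow c L)"

lemma finite_cube: "finite (cube k n)"
  unfolding cube_def using finite_lists_length_eq[of "{1..k}" n] by (simp add: conj_commute)

lemma card_cube: "card (cube k n) = k ^ n"
  unfolding cube_def using card_lists_length_eq[of "{1..k}" n] by (simp add: conj_commute)

lemma cube_Suc: "cube k (Suc n) = (\<Union>i\<in>{1..k}. Cons i ` cube k n)"
  by (auto simp: cube_def length_Suc_conv image_iff)

lemma inj_fill: "None \<in> set w \<Longrightarrow> inj (fill w)"
  by (force simp: inj_def fill_def)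

text \<open>A wildcard makes \<open>fill w\<close> injective, so the points of a line can be indexed
  by the letters.\<close>

lemma rainbow_line_iff:
  assumes "w \<in> root_words k n"
  shows "rainbow c (line k w) \<longleftrightarrow> inj_on (\<lambda>i. c (fill w i)) {1..k}"
proof -
  have "inj_on (fill w) {1..k}"
    using assms inj_fill by (auto simp: root_words_def intro: inj_on_subset)
  then show ?thesis
    unfolding rainbow_def line_def by (simp add: comp_inj_on_iff[of "fill w" _ c] comp_def)
qed

lemma rainbow_free_iff:
  "rainbow_free k n c \<longleftrightarrow>
     (\<forall>w\<in>root_words k n. \<not> inj_on (\<lambda>i. c (fill w i)) {1..k})"
  by (auto simp: rainbow_free_def combinatorial_lines_def rainbow_line_iff)

text \<open>Prefixing a fixed letter to a root word turns each line of the smaller cube into a line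
  inside one layer.\<close>

lemma rainbow_free_layer:
  assumes "rainbow_free k (Suc n) c" "i \<in> {1..k}"
  shows "rainbow_free k n (\<lambda>x. c (i # x))"
  unfolding rainbow_free_iff
proof
  fix w assume "w \<in> root_words k n"
  then have "Some i # w \<in> root_words k (Suc n)"
    using assms(2) by (auto simp: root_words_def)
  with assms(1) have "\<not> inj_on (\<lambda>j. c (fill (Some i # w) j)) {1..k}"
    by (auto simp: rainbow_free_iff)
  then show "\<not> inj_on (\<lambda>j. c (i # fill w j)) {1..k}"
    by (simp add: fill_def)
qed

text \<open>The line whose only wildcard is the first coordinate meets every layer once, always
  above \<open>x\<close>.\<close>

lemma rainbow_free_transversal:
  assumes "rainbow_free k (Suc n) c" "x \<in> cube k n"
  obtains i j where "i \<in> {1..k}" "j \<in> {1..k}" "i \<noteq> j" "c (i # x) = c (j # x)"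
proof -
  have "None # map Some x \<in> root_words k (Suc n)"
    using assms(2) by (auto simp: root_words_def cube_def)
  with assms(1) have "\<not> inj_on (\<lambda>j. c (fill (None # map Some x) j)) {1..k}"
    by (auto simp: rainbow_free_iff)
  moreover have "fill (None # map Some x) j = j # x" for j
    by (simp add: fill_def comp_def)
  ultimately show thesis
    using that by (auto simp: inj_on_def)
qed

section \<open>The recursive upper bound on the number of colors\<close>

text \<open>\<open>Q\<close> collects redundant elements: their values survive when all of
  \<open>Q\<close> is deleted.\<close>

lemma card_image_add_card_le:
  assumes "finite P" "Q \<subseteq> P" "f ` Q \<subseteq> f ` (P - Q)"
  shows "card (f ` P) + card Q \<le> card P"
proof -
  have "f ` P = f ` (P - Q)"
    using assms by auto
  then have "card (f ` P) \<le> card (P - Q)"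
    using assms card_image_le[of "P - Q" f] by simp
  then show ?thesis
    using assms card_mono[of P Q] by (simp add: card_Diff_subset finite_subset)
qed

lemma colors_layer_bound:
  fixes F :: real
  assumes free: "rainbow_free k (Suc n) c" and k: "k \<ge> 1" and F: "F \<ge> 2"
    and layer: "\<And>i. i \<in> {1..k} \<Longrightarrow> real (card ((\<lambda>x. c (i # x)) ` cube k n)) \<le> F"
  shows "real (card (c ` cube k (Suc n))) \<le> real k * F - 2"
proof -
  define A where "A i = (\<lambda>x. c (i # x)) ` cube k n" for i
  \<comment> \<open>Each color is tagged with its layer; the colors lost under \<open>snd\<close>
    measure the overlap between layers.\<close>
  define P where "P = Sigma {1..k} A"
  have finA: "finite (A i)" for i
    by (simp add: A_def finite_cube)
  have finP: "finite P"
    by (simp add: P_def finA)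
  have colors: "c ` cube k (Suc n) = snd ` P"
    by (force simp: cube_Suc P_def A_def)
  have cardP: "real (card P) = (\<Sum>i=1..k. real (card (A i)))"
    by (simp add: P_def finA)
  \<comment> \<open>Any point would do to produce a first coincidence.\<close>
  have "replicate n 1 \<in> cube k n"
    using k by (auto simp: cube_def)
  then obtain i j where ij: "i \<in> {1..k}" "j \<in> {1..k}" "i \<noteq> j"
    and "c (i # replicate n 1) = c (j # replicate n 1)"
    using rainbow_free_transversal[OF free] by blast
  define a where "a = c (i # replicate n 1)"
  have a: "a \<in> A i" "a \<in> A j"
    using \<open>replicate n 1 \<in> cube k n\<close> \<open>c (i # _) = _\<close> unfolding a_def A_def by blast+
  show ?thesis
  proof (cases "A i = {a}")
    \<comment> \<open>Layer \<open>i\<close> contributes a single color and \<open>(j, a)\<close> is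
      redundant, which leaves at most (k - 1) F colors; \<open>F \<ge> 2\<close> finishes.\<close>
    case True
    have "real (card P) = 1 + (\<Sum>l\<in>{1..k} - {i}. real (card (A l)))"
      unfolding cardP using ij True by (subst sum.remove[of _ i]) auto
    also have "\<dots> \<le> 1 + (\<Sum>l\<in>{1..k} - {i}. F)"
      using layer by (intro add_left_mono sum_mono) (auto simp: A_def)
    also have "\<dots> = 1 + (real k - 1) * F"
      using ij k by (simp add: of_nat_diff)
    finally have "real (card P) \<le> 1 + real k * F - F"
      by (simp add: algebra_simps)
    moreover have "card (snd ` P) + card {(j, a)} \<le> card P"
    proof (rule card_image_add_card_le[OF finP])
      have "(i, a) \<in> P - {(j, a)}"
        using ij a by (auto simp: P_def)
      then show "snd ` {(j, a)} \<subseteq> snd ` (P - {(j, a)})"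
        by force
    qed (use ij a in \<open>auto simp: P_def\<close>)
    ultimately show ?thesis
      using F unfolding colors by simp
  next
    case False
    \<comment> \<open>The line above this \<open>x\<close> cannot repeat the coincidence of color
      \<open>a\<close> in layers \<open>i\<close> and \<open>j\<close>.\<close>
    with a obtain x where x: "x \<in> cube k n" "c (i # x) \<noteq> a"
      by (auto simp: A_def)
    obtain i' j' where ij': "i' \<in> {1..k}" "j' \<in> {1..k}" "i' \<noteq> j'"
      and eq: "c (i' # x) = c (j' # x)"
      using rainbow_free_transversal[OF free x(1)] by blast
    define b where "b = c (i' # x)"
    have b: "b \<in> A i'" "b \<in> A j'"
      using x(1) eq unfolding b_def A_def by blast+
    obtain Q where Q: "Q \<subseteq> P" "card Q = 2" "snd ` Q \<subseteq> snd ` (P - Q)"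
    proof (cases "a = b")
      case True
      then have "i' \<noteq> i" "j' \<noteq> i"
        using x(2) eq by (auto simp: b_def)
      then have "(i, a) \<in> P - {(i', a), (j', a)}"
        using ij a by (auto simp: P_def)
      then have "snd ` {(i', a), (j', a)} \<subseteq> snd ` (P - {(i', a), (j', a)})"
        by force
      then show thesis
        using ij' b True by (intro that[of "{(i', a), (j', a)}"]) (auto simp: P_def)
    next
      case False
      then have "(i, a) \<in> P - {(j, a), (j', b)}" "(i', b) \<in> P - {(j, a), (j', b)}"
        using ij ij' a b by (auto simp: P_def)
      then have "snd ` {(j, a), (j', b)} \<subseteq> snd ` (P - {(j, a), (j', b)})"
        by force
      then show thesis
        using False ij ij' a b by (intro that[of "{(j, a), (j', b)}"]) (auto simp: P_def)
    qed
    have "real (card P) \<le> (\<Sum>l=1..k. F)"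
      unfolding cardP using layer by (intro sum_mono) (auto simp: A_def)
    then have "real (card P) \<le> real k * F"
      by simp
    moreover have "card (snd ` P) + 2 \<le> card P"
      using card_image_add_card_le[OF finP Q(1,3)] Q(2) by simp
    ultimately show ?thesis
      unfolding colors by linarith
  qed
qed

text \<open>The cube of dimension one is itself a single line.\<close>

lemma colors_dim_one:
  assumes free: "rainbow_free k 1 c"
  shows "card (c ` cube k 1) < k"
proof -
  have cube: "cube k 1 = (\<lambda>i. [i]) ` {1..k}"
    using cube_Suc[of k 0] by (auto simp: cube_def)
  have "\<not> inj_on (\<lambda>i. c [i]) {1..k}"
  proof -
    have "[] \<in> cube k 0"
      by (simp add: cube_def)
    with free obtain i j where "i \<in> {1..k}" "j \<in> {1..k}" "i \<noteq> j" "c [i] = c [j]"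
      using rainbow_free_transversal[of k 0 c "[]"] by auto
    then show ?thesis
      by (meson inj_onD)
  qed
  then have "card ((\<lambda>i. c [i]) ` {1..k}) < k"
    using card_image_le[of "{1..k}" "\<lambda>i. c [i]"] eq_card_imp_inj_on[of "{1..k}" "\<lambda>i. c [i]"]
    by (fastforce simp: le_less)
  then show ?thesis
    unfolding cube image_image .
qed

text \<open>The right-hand side solves the recursion F \<mapsto> k F - 2 started at k - 1; its fixed
  point is 2 / (k - 1).\<close>

lemma rainbow_free_colors_bound:
  assumes k: "k > 2" and free: "rainbow_free k (Suc n) c"
  shows "real (card (c ` cube k (Suc n)))
    \<le> ((real k - 1)\<^sup>2 - 2) / (real k - 1) * real k ^ n + 2 / (real k - 1)"
  using free
proof (induction n arbitrary: c)
  case 0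
  have "real (card (c ` cube k 1)) \<le> real k - 1"
    using colors_dim_one[of k c] 0 by simp
  also have "\<dots> = ((real k - 1)\<^sup>2 - 2) / (real k - 1) + 2 / (real k - 1)"
    using k by (simp add: power2_eq_square flip: add_divide_distrib)
  finally show ?case by simp
next
  case (Suc n)
  let ?F = "((real k - 1)\<^sup>2 - 2) / (real k - 1) * real k ^ n + 2 / (real k - 1)"
  \<comment> \<open>This makes the coefficient of the power of \<open>k\<close> nonnegative, so
    \<open>?F\<close> is at least its initial value k - 1.\<close>
  have sq: "(real k - 1)\<^sup>2 \<ge> 2\<^sup>2"
    using k by (intro power_mono) auto
  have "2 \<le> real k - 1"
    using k by simp
  also have "\<dots> = ((real k - 1)\<^sup>2 - 2) / (real k - 1) * 1 + 2 / (real k - 1)"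
    using k by (simp add: power2_eq_square flip: add_divide_distrib)
  also have "\<dots> \<le> ?F"
    using k sq by (intro add_right_mono mult_left_mono) auto
  finally have "?F \<ge> 2" .
  then have "real (card (c ` cube k (Suc (Suc n)))) \<le> real k * ?F - 2"
    using k Suc.IH[OF rainbow_free_layer[OF Suc.prems]] Suc.prems
    by (intro colors_layer_bound) auto
  also have "\<dots> = ((real k - 1)\<^sup>2 - 2) / (real k - 1) * real k ^ Suc n + 2 / (real k - 1)"
  proof -
    have "real k * (2 / (real k - 1)) - 2 = 2 / (real k - 1)"
      using k by (simp add: field_simps)
    then show ?thesis
      by (simp add: distrib_left mult.left_commute)
  qed
  finally show ?case .
qed

section \<open>The lower bound and the value of \<open>ah\<close>\<close>

text \<open>All smaller \<open>r\<close> are covered as well, because \<open>ah\<close> is a least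
  number: excluding only the largest value would not bound it from below.\<close>

lemma ex_rainbow_free_coloring:
  assumes k: "k \<ge> 2" and r: "1 \<le> r" "r \<le> (k - 1) ^ n"
  shows "\<exists>c. is_coloring r k n c \<and> rainbow_free k n c"
proof -
  define m where "m = map (min (k - 1))"
  obtain h where h: "bij_betw h (cube (k - 1) n) {0..<(k - 1) ^ n}"
    using ex_bij_betw_finite_nat[OF finite_cube, of "k - 1" n] by (auto simp: card_cube)
  \<comment> \<open>\<open>h\<close> numbers the words without letter \<open>k\<close>; capping at
    \<open>r - 1\<close> merges the surplus, leaving exactly the colors below
    \<open>r\<close>.\<close>
  define c where "c = (\<lambda>x. min (r - 1) (h (m x)))"
  have "m ` cube k n = cube (k - 1) n"
  proof (intro equalityI subsetI)
    fix x assume x: "x \<in> cube (k - 1) n"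
    then have "m x = x"
      by (auto simp: m_def cube_def intro!: map_idI)
    moreover have "x \<in> cube k n"
      using x by (fastforce simp: cube_def)
    ultimately show "x \<in> m ` cube k n"
      by force
  qed (use k in \<open>fastforce simp: m_def cube_def\<close>)
  moreover have "c ` cube k n = min (r - 1) ` h ` m ` cube k n"
    by (simp add: c_def image_image)
  ultimately have "c ` cube k n = min (r - 1) ` {0..<(k - 1) ^ n}"
    using h by (simp add: bij_betw_def)
  also have "\<dots> = {0..<r}"
  proof (intro equalityI subsetI)
    fix y assume "y \<in> {0..<r}"
    then show "y \<in> min (r - 1) ` {0..<(k - 1) ^ n}"
      using r by (intro image_eqI[of _ _ y]) auto
  qed (use r in auto)
  finally have "is_coloring r k n c"
    by (simp add: is_coloring_def)
  moreover have "rainbow_free k n c"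
    unfolding rainbow_free_iff
  proof
    fix w assume "w \<in> root_words k n"
    have "m (fill w (k - 1)) = m (fill w k)"
      by (auto simp: m_def fill_def split: option.split)
    then have "c (fill w (k - 1)) = c (fill w k)"
      by (simp add: c_def)
    moreover have "k - 1 \<in> {1..k}" "k \<in> {1..k}" "k - 1 \<noteq> k"
      using k by auto
    ultimately show "\<not> inj_on (\<lambda>i. c (fill w i)) {1..k}"
      by (meson inj_onD)
  qed
  ultimately show ?thesis by blast
qed

theorem theorem2p2:
  fixes k n :: nat
  assumes "k > 2" and "n > 2"
  shows "(real k - 1) ^ n < real (ah k n) \<and>
    real (ah k n) \<le> ((real k - 1)\<^sup>2 - 2) / (real k - 1) * real k ^ (n - 1)
                      + (real k + 1) / (real k - 1)"
proof -
  define B where "B = ((real k - 1)\<^sup>2 - 2) / (real k - 1) * real k ^ (n - 1)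
                      + (real k + 1) / (real k - 1)"
  define forced where "forced r \<longleftrightarrow> r \<ge> 1 \<and>
    (\<forall>c. is_coloring r k n c \<longrightarrow> \<not> rainbow_free k n c)" for r
  have ah: "ah k n = (LEAST r. forced r)"
    by (simp add: ah_def forced_def rainbow_free_def)
  \<comment> \<open>The additional 1 is the step from the most colors without a rainbow line to a
    number that forces one.\<close>
  have "(real k + 1) / (real k - 1) = 2 / (real k - 1) + 1"
    using assms by (simp add: field_simps)
  then have B_eq: "B = ((real k - 1)\<^sup>2 - 2) / (real k - 1) * real k ^ (n - 1) + 2 / (real k - 1) + 1"
    by (simp add: B_def)
  have "(real k - 1)\<^sup>2 \<ge> 2\<^sup>2"
    using assms by (intro power_mono) auto
  then have "B \<ge> 1"
    using assms by (simp add: B_eq)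
  have "real r \<le> B - 1" if "is_coloring r k n c" "rainbow_free k n c" for r c
    using rainbow_free_colors_bound[of k "n - 1" c] that assms
    by (simp add: B_eq is_coloring_def)
  \<comment> \<open>An integer above \<open>B - 1\<close> exceeds every rainbow-free color count,
    hence is \<open>forced\<close>.\<close>
  moreover have "real (nat \<lfloor>B\<rfloor>) > B - 1"
    using \<open>B \<ge> 1\<close> by linarith
  moreover have "nat \<lfloor>B\<rfloor> \<ge> 1"
    using \<open>B \<ge> 1\<close> by (intro le_nat_floor) simp
  ultimately have forced: "forced (nat \<lfloor>B\<rfloor>)"
    unfolding forced_def by (meson not_less)
  then have "ah k n \<le> nat \<lfloor>B\<rfloor>"
    unfolding ah by (rule Least_le)
  then have upper: "real (ah k n) \<le> B"
    using \<open>B \<ge> 1\<close> by linarith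
  \<comment> \<open>The minimum is attained, whereas no \<open>r\<close> from 1 to (k - 1)^n is
    \<open>forced\<close>.\<close>
  have "forced (ah k n)"
    unfolding ah using forced by (rule LeastI)
  then have "(k - 1) ^ n < ah k n"
    using ex_rainbow_free_coloring[of k "ah k n" n] assms
    by (force simp: forced_def not_less)
  then have "real ((k - 1) ^ n) < real (ah k n)"
    by (simp only: of_nat_less_iff)
  then have "(real k - 1) ^ n < real (ah k n)"
    using assms by (simp add: of_nat_diff)
  with upper show ?thesis
    by (simp add: B_def)
qed

end
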